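(* Let $\mathcal{M}$ be a constrained Markov decision process with fixed initial state $s\in\mathcal{S}$ and total damage budget $\Delta$, and let $\tilde{\mathcal{M}}$ be its augmented MDP. Then the optimization problem $$\text{(A)}\quad \max_{\tilde\pi\in\tilde\Pi_H}\ \mathbb{E}_{\tilde\pi,\tilde{\mathcal{M}}}\Big[\sum_{t=0}^\infty R_{t+1}\,\Big|\,(S_0,K_0)=(s,\Delta)\Big]\quad\text{s.t.}\quad P_{\tilde\pi}\big(\tilde D_{t+1}=0\big)=1\ \ \forall t\ge 0$$ in the augmented MDP $\tilde{\mathcal{M}}$ is equivalent to the optimization problem $$\text{(O)}\quad \max_{\pi\in\Pi_H}\ \mathbb{E}_{\pi}\Big[\sum_{t=0}^\infty R_{t+1}\,\Big|\,S_0=s\Big]\quad\text{s.t.}\quad P_\pi\Big(\sum_{t=0}^\infty D_{t+1}\le\Delta\,\Big|\,S_0=s\Big)=1$$ in the original MDP $\mathcal{M}$.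
   Context: A constrained Markov decision process (CMDP) $\mathcal{M}=(\mathcal{S},\mathcal{A},p,r,d)$ has a finite state set $\mathcal{S}$, a finite action set $\mathcal{A}$, infinite horizon, and a transition kernel $p(s',r,d\mid s,a)$ giving the conditional law of the next state $S_{t+1}=s'$, the reward $R_{t+1}=r\in\mathbb{R}$ and the binary damage indicator $D_{t+1}=d\in\{0,1\}$ given $S_t=s$, $A_t=a$. The total damage budget $\Delta$ is a user-specified nonnegative integer. Standing assumptions: there is an absorbing termination state in which the system remains with no further reward, and this state is eventually reached under any policy. The history of $\mathcal{M}$ at time $t$ is $h_t=(s_0,a_0,r_1,d_1,s_1,\dots,s_{t-1},a_{t-1},r_t,d_t,s_t)$. $\Pi_H$ is the set of history-dependent policies, which choose $A_t$ according to a distribution $\pi(\cdot\mid h_t)$ on $\mathcal{A}$. The budget is $K_0=\Delta$ and $K_t=\Delta-\sum_{\ell=0}^{t-1}D_{\ell+1}$ for $t\ge1$, so $K_{t+1}=K_t-D_{t+1}$. Given transition tuples $(S_t,A_t,S_{t+1},R_{t+1},D_{t+1})$ of $\mathcal{M}$, the augmented MDP $\tilde{\mathcal{M}}$ is the one with tuples $(\tilde S_t,A_t,\tilde S_{t+1},R_{t+1},\tilde D_{t+1})$, where $\tilde S_t=(S_t,K_t)$ and $\tilde D_{t+1}=\mathbf{1}\{K_t-D_{t+1}<0\}$; its states lie in $\mathcal{S}\times\{\Delta,\Delta-1,\dots,0\}$, and $\tilde D_{t+1}=1$ signifies failure (the system is out of budget). In (A) the initial state of $\tilde{\mathcal{M}}$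 is $(S_0,K_0)=(s,\Delta)$, with the same $s$ as in (O). $\tilde\Pi_H$ is the set of history-dependent policies $\tilde\pi(\cdot\mid\tilde h_t)$ of $\tilde{\mathcal{M}}$, with $\tilde h_t=(\tilde s_0,a_0,r_1,\tilde d_1,\tilde s_1,\dots,\tilde s_{t-1},a_{t-1},r_t,\tilde d_t,\tilde s_t)$. $\mathbb{E}_{\tilde\pi,\tilde{\mathcal{M}}}$ is the expectation over trajectories induced by $\tilde{\mathcal{M}}$ under $\tilde\pi$. The word "equivalent" is introduced with the explanation that any given feasible general (history-dependent) policy for $\tilde{\mathcal{M}}$ can be mapped to a corresponding policy in $\mathcal{M}$, and vice versa. *)

theory Defs
  imports "HOL-Probability.Probability"
begin

text \<open>
  A kernel value is the joint law of (next state, reward, damage indicator). The same record is used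
  for a constrained MDP and for its augmentation, whose damage indicator is the failure indicator.
\<close>

record ('s, 'a) mdp =
  states :: "'s set"
  actions :: "'a set"
  kernel :: "'s \<Rightarrow> 'a \<Rightarrow> ('s \<times> real \<times> bool) measure"

definition outcome_space :: "'s set \<Rightarrow> ('s \<times> real \<times> bool) measure" where
  "outcome_space S = count_space S \<Otimes>\<^sub>M borel \<Otimes>\<^sub>M count_space UNIV"

locale finite_mdp =
  fixes M :: "('s, 'a) mdp"
  assumes finite_states: "finite (states M)"
    and finite_actions: "finite (actions M)"
    and kernel: "\<And>s a. s \<in> states M \<Longrightarrow> a \<in> actions M \<Longrightarrow>
      kernel M s a \<in> space (prob_algebra (outcome_space (states M)))"

text \<open>
  The \<open>t\<close>-th step of a trajectory is \<open>(a\<^sub>t, r\<^sub>t\<^sub>+\<^sub>1, d\<^sub>t\<^sub>+\<^sub>1, s\<^sub>t\<^sub>+\<^sub>1)\<close>. A history at time \<open>t\<close> is the initial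
  state together with the steps with indices in \<open>{0..<t}\<close>.
\<close>

type_synonym ('s, 'a) step = "'a \<times> real \<times> bool \<times> 's"
type_synonym ('s, 'a) history = "'s \<times> (nat \<Rightarrow> ('s, 'a) step)"

definition step_reward :: "('s, 'a) step \<Rightarrow> real" where
  "step_reward x = fst (snd x)"

definition step_damage :: "('s, 'a) step \<Rightarrow> bool" where
  "step_damage x = fst (snd (snd x))"

definition step_state :: "('s, 'a) step \<Rightarrow> 's" where
  "step_state x = snd (snd (snd x))"

definition state_at :: "('s, 'a) history \<Rightarrow> nat \<Rightarrow> 's" where
  "state_at h t = (case t of 0 \<Rightarrow> fst h | Suc i \<Rightarrow> step_state (snd h i))"

definition step_space :: "('s, 'a) mdp \<Rightarrow> ('s, 'a) step measure" where
  "step_space M =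
    count_space (actions M) \<Otimes>\<^sub>M borel \<Otimes>\<^sub>M count_space UNIV \<Otimes>\<^sub>M count_space (states M)"

definition history_space :: "('s, 'a) mdp \<Rightarrow> nat \<Rightarrow> ('s, 'a) history measure" where
  "history_space M t = count_space (states M) \<Otimes>\<^sub>M PiM {0..<t} (\<lambda>_. step_space M)"

type_synonym ('s, 'a) policy = "nat \<Rightarrow> ('s, 'a) history \<Rightarrow> 'a measure"

definition policies :: "('s, 'a) mdp \<Rightarrow> ('s, 'a) policy set" where
  "policies M = {\<pi>. \<forall>t. \<pi> t \<in> history_space M t \<rightarrow>\<^sub>M prob_algebra (count_space (actions M))}"

definition step_law ::
    "('s, 'a) mdp \<Rightarrow> ('s, 'a) policy \<Rightarrow> 's \<Rightarrow> nat \<Rightarrow> (nat \<Rightarrow> ('s, 'a) step) \<Rightarrow> ('s, 'a) step measure" where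
  "step_law M \<pi> s t \<omega> = \<pi> t (s, \<omega>) \<bind>
    (\<lambda>a. distr (kernel M (state_at (s, \<omega>) t) a) (step_space M) (\<lambda>(s', r, d). (a, r, d, s')))"

text \<open>
  Law of the sequence of steps started in \<open>s\<close>: the Ionescu-Tulcea measure of the conditional step
  laws. The lemma \<open>Ionescu_Tulcea_step_law\<close> below discharges the assumptions of that construction.
\<close>

definition trajectory ::
    "('s, 'a) mdp \<Rightarrow> ('s, 'a) policy \<Rightarrow> 's \<Rightarrow> (nat \<Rightarrow> ('s, 'a) step) measure" where
  "trajectory M \<pi> s = projective_family.lim UNIV
    (Ionescu_Tulcea.CI (step_law M \<pi> s) (\<lambda>_. step_space M)) (\<lambda>_. step_space M)"

locale cmdp = finite_mdp M for M :: "('s, 'a) mdp" +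
  assumes absorbing: "\<exists>z\<in>states M.
    (\<forall>a\<in>actions M. AE (s', r, d) in kernel M z a. s' = z \<and> r = 0) \<and>
    (\<forall>\<pi>\<in>policies M. \<forall>s\<in>states M. AE \<omega> in trajectory M \<pi> s. \<exists>t. state_at (s, \<omega>) t = z)"

text \<open>
  The budget component is a natural number, so that \<open>k - of_bool d\<close> is truncated at 0: the state
  space is \<open>states M \<times> {0..\<Delta>}\<close> also after a failure.
\<close>

definition augment :: "nat \<Rightarrow> ('s, 'a) mdp \<Rightarrow> ('s \<times> nat, 'a) mdp" where
  "augment \<Delta> M = \<lparr>
    states = states M \<times> {0..\<Delta>},
    actions = actions M,
    kernel = (\<lambda>(s, k) a. distr (kernel M s a) (outcome_space (states M \<times> {0..\<Delta>}))
      (\<lambda>(s', r, d). ((s', k - of_bool d), r, int k - of_bool d < 0)))\<rparr>"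

definition total_reward :: "(nat \<Rightarrow> ('s, 'a) step) \<Rightarrow> real" where
  "total_reward \<omega> = (\<Sum>t. step_reward (\<omega> t))"

definition has_return :: "('s, 'a) mdp \<Rightarrow> 's \<Rightarrow> ('s, 'a) policy \<Rightarrow> real \<Rightarrow> bool" where
  "has_return M s \<pi> v \<longleftrightarrow> has_bochner_integral (trajectory M \<pi> s) total_reward v"

definition feasible :: "nat \<Rightarrow> ('s, 'a) mdp \<Rightarrow> 's \<Rightarrow> ('s, 'a) policy set" where
  "feasible \<Delta> M s = {\<pi>\<in>policies M.
    \<P>(\<omega> in trajectory M \<pi> s. (\<Sum>t. of_bool (step_damage (\<omega> t)) :: ennreal) \<le> of_nat \<Delta>) = 1}"

definition feasible_aug :: "nat \<Rightarrow> ('s, 'a) mdp \<Rightarrow> 's \<Rightarrow> ('s \<times> nat, 'a) policy set" where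
  "feasible_aug \<Delta> M s = {\<pi>\<in>policies (augment \<Delta> M).
    \<forall>t. \<P>(\<omega> in trajectory (augment \<Delta> M) \<pi> (s, \<Delta>). \<not> step_damage (\<omega> t)) = 1}"

text \<open>Truncated at 0, like the budget component of \<open>augment\<close>.\<close>

definition budget :: "nat \<Rightarrow> (nat \<Rightarrow> ('s, 'a) step) \<Rightarrow> nat \<Rightarrow> nat" where
  "budget \<Delta> \<omega> t = \<Delta> - (\<Sum>l<t. of_bool (step_damage (\<omega> l)))"

definition aug_history :: "nat \<Rightarrow> nat \<Rightarrow> ('s, 'a) history \<Rightarrow> ('s \<times> nat, 'a) history" where
  "aug_history \<Delta> t h = (case h of (s, \<omega>) \<Rightarrow>
    ((s, \<Delta>), \<lambda>i\<in>{0..<t}. case \<omega> i of (a, r, d, s') \<Rightarrow>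
      (a, r, int (budget \<Delta> \<omega> i) - of_bool d < 0, (s', budget \<Delta> \<omega> (Suc i)))))"

text \<open>
  Corresponding policies draw the action at time \<open>t\<close> from the same distribution, at every history of
  \<open>M\<close> and at its image in the augmented MDP. The components \<open>d\<close> can be recovered from that image:
  a damage either decreases the budget or causes a failure.
\<close>

definition corresponds ::
    "nat \<Rightarrow> ('s, 'a) mdp \<Rightarrow> ('s \<times> nat, 'a) policy \<Rightarrow> ('s, 'a) policy \<Rightarrow> bool" where
  "corresponds \<Delta> M \<pi>' \<pi> \<longleftrightarrow>
    (\<forall>t. \<forall>h\<in>space (history_space M t). \<pi>' t (aug_history \<Delta> t h) = \<pi> t h)"

text \<open>
  \<open>F\<close> is a feasible set and \<open>V x v\<close> says that the objective is defined at \<open>x\<close> with value \<open>v\<close>. A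
  relation is used because nothing forces the rewards to be integrable. The quantifier over \<open>v\<close> in
  \<open>equivalent_problems\<close> therefore also says that one objective is defined iff the other is.
\<close>

definition equivalent_problems ::
    "('x \<Rightarrow> 'y \<Rightarrow> bool) \<Rightarrow> 'x set \<Rightarrow> ('x \<Rightarrow> real \<Rightarrow> bool) \<Rightarrow> 'y set \<Rightarrow> ('y \<Rightarrow> real \<Rightarrow> bool) \<Rightarrow> bool" where
  "equivalent_problems C F V F' V' \<longleftrightarrow>
    (\<forall>x\<in>F. \<exists>y\<in>F'. C x y) \<and>
    (\<forall>y\<in>F'. \<exists>x\<in>F. C x y) \<and>
    (\<forall>x\<in>F. \<forall>y\<in>F'. C x y \<longrightarrow> (\<forall>v. V x v \<longleftrightarrow> V' y v))"

definition maximizer :: "'x set \<Rightarrow> ('x \<Rightarrow> real \<Rightarrow> bool) \<Rightarrow> 'x \<Rightarrow> bool" where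
  "maximizer F V x \<longleftrightarrow> x \<in> F \<and> (\<exists>v. V x v \<and> (\<forall>y\<in>F. \<forall>w. V y w \<longrightarrow> w \<le> v))"

definition optimal_value :: "'x set \<Rightarrow> ('x \<Rightarrow> real \<Rightarrow> bool) \<Rightarrow> ereal" where
  "optimal_value F V = (SUP v\<in>{v. \<exists>x\<in>F. V x v}. ereal v)"

lemma equivalent_problems_values:
  assumes "equivalent_problems C F V F' V'"
  shows "{v. \<exists>x\<in>F. V x v} = {v. \<exists>y\<in>F'. V' y v}"
  using assms unfolding equivalent_problems_def by blast

lemma equivalent_problems_optimal_value:
  assumes "equivalent_problems C F V F' V'"
  shows "optimal_value F V = optimal_value F' V'"
  using equivalent_problems_values[OF assms] by (simp add: optimal_value_def)

lemma equivalent_problems_maximizer: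
  assumes "equivalent_problems C F V F' V'" "x \<in> F" "y \<in> F'" "C x y"
  shows "maximizer F V x \<longleftrightarrow> maximizer F' V' y"
  using assms unfolding equivalent_problems_def maximizer_def by meson

lemma measurable_state_at:
  assumes "s \<in> states M"
  shows "(\<lambda>\<omega>. state_at (s, \<omega>) t) \<in> PiM {0..<t} (\<lambda>_. step_space M) \<rightarrow>\<^sub>M count_space (states M)"
proof (cases t)
  case 0
  then show ?thesis using assms by (simp add: state_at_def)
next
  case (Suc i)
  have "(\<lambda>\<omega>. \<omega> i) \<in> PiM {0..<t} (\<lambda>_. step_space M) \<rightarrow>\<^sub>M step_space M"
    using Suc by (intro measurable_component_singleton) auto
  moreover have "step_state \<in> step_space M \<rightarrow>\<^sub>M count_space (states M)"
    unfolding step_space_def step_state_def by measurable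
  ultimately have "(\<lambda>\<omega>. step_state (\<omega> i)) \<in> PiM {0..<t} (\<lambda>_. step_space M) \<rightarrow>\<^sub>M count_space (states M)"
    by (rule measurable_compose)
  then show ?thesis using Suc by (simp add: state_at_def)
qed

lemma (in finite_mdp) measurable_step_law:
  assumes \<pi>: "\<pi> \<in> policies M" and s: "s \<in> states M"
  shows "step_law M \<pi> s t \<in> PiM {0..<t} (\<lambda>_. step_space M) \<rightarrow>\<^sub>M prob_algebra (step_space M)"
proof -
  let ?H = "PiM {0..<t} (\<lambda>_. step_space M)"
  let ?Q = "\<lambda>(s', a). distr (kernel M s' a) (step_space M) (\<lambda>(s', r, d). (a, r, d, s'))"
  have pair: "(\<lambda>\<omega>. (s, \<omega>)) \<in> ?H \<rightarrow>\<^sub>M history_space M t"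
    unfolding history_space_def using s by simp
  have pol: "(\<lambda>\<omega>. \<pi> t (s, \<omega>)) \<in> ?H \<rightarrow>\<^sub>M prob_algebra (count_space (actions M))"
    using \<pi> by (auto simp: policies_def intro: measurable_compose[OF pair])
  have Q_mem: "?Q x \<in> space (prob_algebra (step_space M))" if "x \<in> states M \<times> actions M" for x
  proof -
    obtain s' a where x: "x = (s', a)" "s' \<in> states M" "a \<in> actions M" using \<open>x \<in> _\<close> by auto
    have K: "kernel M s' a \<in> space (prob_algebra (outcome_space (states M)))"
      using kernel x by blast
    have "(\<lambda>(s', r, d). (a, r, d, s')) \<in> outcome_space (states M) \<rightarrow>\<^sub>M step_space M"
      unfolding outcome_space_def step_space_def case_prod_beta'
      by (intro measurable_Pair measurable_const measurable_compose[OF measurable_snd]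
          measurable_fst measurable_snd) (simp add: x)
    then have "(\<lambda>(s', r, d). (a, r, d, s')) \<in> kernel M s' a \<rightarrow>\<^sub>M step_space M"
      using K by (simp add: space_prob_algebra cong: measurable_cong_sets)
    then show ?thesis
      using K by (auto simp: x space_prob_algebra intro!: prob_space.prob_space_distr)
  qed
  have Q: "?Q \<in> count_space (states M \<times> actions M) \<rightarrow>\<^sub>M prob_algebra (step_space M)"
    using Q_mem by auto
  have eq: "count_space (states M) \<Otimes>\<^sub>M count_space (actions M) = count_space (states M \<times> actions M)"
    by (intro pair_measure_count_space finite_states finite_actions)
  have "(\<lambda>(\<omega>, a). (state_at (s, \<omega>) t, a)) \<in>
      ?H \<Otimes>\<^sub>M count_space (actions M) \<rightarrow>\<^sub>M count_space (states M) \<Otimes>\<^sub>M count_space (actions M)"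
    using measurable_state_at[OF s, of t] by measurable
  then have "(\<lambda>x. ?Q ((\<lambda>(\<omega>, a). (state_at (s, \<omega>) t, a)) x)) \<in>
      ?H \<Otimes>\<^sub>M count_space (actions M) \<rightarrow>\<^sub>M prob_algebra (step_space M)"
    unfolding eq by (rule measurable_compose[OF _ Q])
  then have ker: "(\<lambda>(\<omega>, a). distr (kernel M (state_at (s, \<omega>) t) a) (step_space M)
        (\<lambda>(s', r, d). (a, r, d, s'))) \<in>
      ?H \<Otimes>\<^sub>M count_space (actions M) \<rightarrow>\<^sub>M prob_algebra (step_space M)"
    by (simp add: case_prod_beta')
  show ?thesis
    unfolding step_law_def[abs_def] by (rule measurable_bind_prob_space2[OF pol ker])
qed

lemma (in finite_mdp) Ionescu_Tulcea_step_law: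
  assumes "\<pi> \<in> policies M" "s \<in> states M"
  shows "Ionescu_Tulcea (step_law M \<pi> s) (\<lambda>_. step_space M)"
proof (rule Ionescu_Tulcea.intro)
  fix t
  note law = measurable_step_law[OF assms, of t]
  show "step_law M \<pi> s t \<in> PiM {0..<t} (\<lambda>_. step_space M) \<rightarrow>\<^sub>M subprob_algebra (step_space M)"
    using law by (rule measurable_prob_algebraD)
  fix \<omega> assume "\<omega> \<in> space (PiM {0..<t} (\<lambda>_. step_space M))"
  from measurable_space[OF law this] show "prob_space (step_law M \<pi> s t \<omega>)"
    by (simp add: space_prob_algebra)
qed

lemma (in finite_mdp) finite_mdp_augment: "finite_mdp (augment \<Delta> M)"
proof
  fix x a assume "x \<in> states (augment \<Delta> M)" "a \<in> actions (augment \<Delta> M)"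
  then obtain s k where x: "x = (s, k)" "s \<in> states M" "k \<le> \<Delta>" and a: "a \<in> actions M"
    by (auto simp: augment_def)
  let ?f = "\<lambda>(s', r, d). ((s', k - of_bool d), r :: real, int k - of_bool d < 0)"
  have K: "kernel M s a \<in> space (prob_algebra (outcome_space (states M)))"
    using kernel x a by blast
  have eq: "count_space (states M \<times> {0..\<Delta>}) = count_space (states M) \<Otimes>\<^sub>M count_space {0..\<Delta>}"
    by (intro pair_measure_count_space[symmetric] finite_states) simp
  have k: "(\<lambda>d. k - of_bool d) \<in> count_space UNIV \<rightarrow>\<^sub>M count_space {0..\<Delta>}"
    using x by auto
  have dmg: "(\<lambda>x. snd (snd x)) \<in> count_space (states M) \<Otimes>\<^sub>M borel \<Otimes>\<^sub>M count_space UNIV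
      \<rightarrow>\<^sub>M count_space UNIV"
    by (rule measurable_compose[OF measurable_snd measurable_snd])
  have "?f \<in> outcome_space (states M) \<rightarrow>\<^sub>M outcome_space (states M \<times> {0..\<Delta>})"
    unfolding outcome_space_def eq case_prod_beta'
    by (intro measurable_Pair measurable_compose[OF measurable_snd measurable_fst] measurable_fst
        measurable_compose[OF dmg k] measurable_compose[OF dmg measurable_count_space])
  then have "?f \<in> kernel M s a \<rightarrow>\<^sub>M outcome_space (states M \<times> {0..\<Delta>})"
    using K by (simp add: space_prob_algebra cong: measurable_cong_sets)
  then show "kernel (augment \<Delta> M) x a \<in> space (prob_algebra (outcome_space (states (augment \<Delta> M))))"
    using K by (auto simp: x augment_def space_prob_algebra intro!: prob_space.prob_space_distr)
qed (simp_all add: augment_def finite_states finite_actions)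

end

theory Submission
  imports Defs
begin

text \<open>
  The augmented trajectory is a deterministic function of the original one: at time \<open>t\<close> it depends
  on the first \<open>t\<close> steps only, and it pushes the step law of a policy of \<open>M\<close> forward to the step
  law of any corresponding policy. By uniqueness of the Ionescu-Tulcea measure the whole trajectory
  law is pushed forward. The map keeps the rewards, and no failure ever occurs in the image iff the
  partial sums of the damages never exceed \<open>\<Delta>\<close>. As the map on histories has a measurable left
  inverse, policies can be transported in both directions.
\<close>

section \<open>Push-forward of Ionescu-Tulcea measures along nonanticipating maps\<close>

text \<open>Both sides are measures on an infinite product, so it suffices to compare them on finite
  cylinders. Since \<open>F\<close> does not look ahead, the first \<open>n\<close> image
  coordinates are a function of the first \<open>n\<close> original ones. The laws of these prefixes
  agree by induction on \<open>n\<close>, with \<open>step\<close> as the one-step extension.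
  \<open>meas\<close> allows any larger \<open>J\<close>, so that it serves finite prefixes and
  \<open>UNIV\<close> alike.\<close>

lemma Ionescu_Tulcea_lim_distr:
  fixes M :: "nat \<Rightarrow> 'a measure" and M' :: "nat \<Rightarrow> 'b measure"
    and F :: "(nat \<Rightarrow> 'a) \<Rightarrow> nat \<Rightarrow> 'b"
  assumes IT: "Ionescu_Tulcea P M" and IT': "Ionescu_Tulcea P' M'"
    and meas: "\<And>i J. {0..<Suc i} \<subseteq> J \<Longrightarrow> (\<lambda>\<omega>. F \<omega> i) \<in> PiM J M \<rightarrow>\<^sub>M M' i"
    and nonanticipating: "\<And>i \<omega> \<omega>'. (\<And>j. j \<le> i \<Longrightarrow> \<omega> j = \<omega>' j) \<Longrightarrow> F \<omega> i = F \<omega>' i"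
    and step: "\<And>n \<omega>. \<omega> \<in> space (PiM {0..<n} M) \<Longrightarrow>
      P' n (restrict (F \<omega>) {0..<n}) = distr (P n \<omega>) (M' n) (\<lambda>x. F (fun_upd \<omega> n x) n)"
  shows "projective_family.lim UNIV (Ionescu_Tulcea.CI P' M') M' =
    distr (projective_family.lim UNIV (Ionescu_Tulcea.CI P M) M) (PiM UNIV M') F"
proof -
  interpret A: Ionescu_Tulcea P M by (rule IT)
  interpret B: Ionescu_Tulcea P' M' by (rule IT')
  let ?u = "\<lambda>_::nat. undefined"
  define G where "G n \<omega> = restrict (F \<omega>) {0..<n}" for n \<omega>
  have G: "G n \<in> PiM J M \<rightarrow>\<^sub>M PiM {0..<n} M'" if "{0..<n} \<subseteq> J" for n J
    unfolding G_def using that by (intro measurable_restrict meas) auto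
  have F: "F \<in> PiM UNIV M \<rightarrow>\<^sub>M PiM UNIV M'"
  proof -
    have "(\<lambda>\<omega>. restrict (F \<omega>) UNIV) \<in> PiM UNIV M \<rightarrow>\<^sub>M PiM UNIV M'"
      by (intro measurable_restrict meas) simp
    then show ?thesis by (simp add: restrict_UNIV)
  qed
  \<comment> \<open>The type \<open>'c\<close> stays free because the fact is used for both
    processes; \<open>N\<close> is a step law in one use and \<open>M' n\<close> in the
    other.\<close>
  have upd: "(\<lambda>x. fun_upd \<omega> n x) \<in> N \<rightarrow>\<^sub>M PiM {0..<Suc n} K"
    if "\<omega> \<in> space (PiM {0..<n} K)" "sets N = sets (K n)" for n N \<omega> and K :: "nat \<Rightarrow> 'c measure"
    using that by (intro measurable_fun_upd[where J="{0..<n}"] measurable_const)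
      (auto simp: measurable_cong_sets[OF that(2) refl])
  \<comment> \<open>\<open>eP n\<close> is the law of a prefix of length \<open>n\<close> extended
    by one random step: extending the image prefix is the same as extending first and then
    mapping.\<close>
  have eP: "B.eP n (G n \<omega>) = distr (A.eP n \<omega>) (PiM {0..<Suc n} M') (G (Suc n))"
    if \<omega>: "\<omega> \<in> space (PiM {0..<n} M)" for n \<omega>
  proof -
    have G\<omega>: "G n \<omega> \<in> space (PiM {0..<n} M')"
      using measurable_space[OF G \<omega>] by simp
    have updA: "(\<lambda>x. fun_upd \<omega> n x) \<in> P n \<omega> \<rightarrow>\<^sub>M PiM {0..<Suc n} M"
      by (rule upd[OF \<omega>]) (rule A.sets_P[OF \<omega>])
    have FA: "(\<lambda>x. F (fun_upd \<omega> n x) n) \<in> P n \<omega> \<rightarrow>\<^sub>M M' n"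
      using measurable_compose[OF updA meas[of n]] by simp
    have "B.eP n (G n \<omega>) = distr (P n \<omega>) (PiM {0..<Suc n} M')
        ((\<lambda>x. fun_upd (G n \<omega>) n x) \<circ> (\<lambda>x. F (fun_upd \<omega> n x) n))"
      unfolding B.eP_def
      by (subst (1) G_def, subst step[OF \<omega>], rule distr_distr[OF upd[OF G\<omega> refl] FA])
    also have "\<dots> = distr (P n \<omega>) (PiM {0..<Suc n} M') (G (Suc n) \<circ> (\<lambda>x. fun_upd \<omega> n x))"
    proof (intro arg_cong2[where f="distr (P n \<omega>)"] ext refl)
      fix x i
      \<comment> \<open>For \<open>i < n\<close> the new coordinate \<open>n\<close> is invisible to
        \<open>F\<close> by nonanticipation; at \<open>i = n\<close> both sides are the new image
        step; beyond that both are \<open>undefined\<close>.\<close>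
      show "((\<lambda>x. fun_upd (G n \<omega>) n x) \<circ> (\<lambda>x. F (fun_upd \<omega> n x) n)) x i =
          (G (Suc n) \<circ> (\<lambda>x. fun_upd \<omega> n x)) x i"
        using nonanticipating[of i \<omega> "fun_upd \<omega> n x"] by (auto simp: G_def)
    qed
    also have "\<dots> = distr (A.eP n \<omega>) (PiM {0..<Suc n} M') (G (Suc n))"
      unfolding A.eP_def by (rule distr_distr[OF G updA, symmetric]) simp
    finally show ?thesis .
  qed
  \<comment> \<open>\<open>?u\<close> is the empty prefix, the only point of the empty product, so
    \<open>C 0 n ?u\<close> is the law of the first \<open>n\<close> coordinates.\<close>
  have C: "B.C 0 n ?u = distr (A.C 0 n ?u) (PiM {0..<n} M') (G n)" for n
  proof (induction n)
    case 0
    have "G 0 = (\<lambda>_. ?u)" by (intro ext) (simp add: G_def)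
    then show ?case by (simp add: distr_return)
  next
    case (Suc n)
    have ne: "space (A.C 0 n ?u) \<noteq> {}"
      by (rule prob_space.not_empty, rule A.prob_space_C) simp
    have sets: "sets (A.C 0 n ?u) = sets (PiM {0..<n} M)" by (simp add: A.sets_C)
    have GC: "G n \<in> A.C 0 n ?u \<rightarrow>\<^sub>M PiM {0..<n} M'"
      unfolding measurable_cong_sets[OF sets refl] by (rule G) simp
    have ePC: "A.eP n \<in> A.C 0 n ?u \<rightarrow>\<^sub>M subprob_algebra (PiM {0..<Suc n} M)"
      unfolding measurable_cong_sets[OF sets refl] by (rule A.measurable_eP)
    have "B.C 0 (Suc n) ?u = A.C 0 n ?u \<bind> (\<lambda>\<omega>. B.eP n (G n \<omega>))"
      by (simp add: Suc bind_distr[OF GC B.measurable_eP ne])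
    also have "\<dots> = A.C 0 n ?u \<bind> (\<lambda>\<omega>. distr (A.eP n \<omega>) (PiM {0..<Suc n} M') (G (Suc n)))"
      by (rule bind_cong[OF refl], rule eP) (simp add: A.space_C)
    also have "\<dots> = distr (A.C 0 (Suc n) ?u) (PiM {0..<Suc n} M') (G (Suc n))"
      by (simp add: distr_bind[OF ePC ne G])
    finally show ?case .
  qed
  show ?thesis
  proof (rule measure_eqI_PiM_infinite[where I=UNIV and M=M'])
    show "finite_measure B.PF.lim"
    proof (rule finite_measureI)
      \<comment> \<open>The whole space is the cylinder over the empty index set, so its mass is
        that of the marginal on no coordinates.\<close>
      have "emeasure B.PF.lim (B.PF.emb UNIV {} (space (PiM {} M'))) = emeasure (B.CI {}) (space (PiM {} M'))"
        by (rule B.lim) auto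
      moreover have "B.PF.emb UNIV {} (space (PiM {} M')) = space B.PF.lim"
        by (auto simp: prod_emb_def space_PiM)
      moreover have "prob_space (B.CI {})" by (rule B.PF.prob_space_P) auto
      ultimately show "emeasure B.PF.lim (space B.PF.lim) \<noteq> \<infinity>"
        using finite_measure.emeasure_finite[of "B.CI {}"] by (simp add: prob_space_def)
    qed
  next
    fix A :: "nat \<Rightarrow> 'b set" and J :: "nat set"
    assume J: "finite J" and A: "\<And>i. i \<in> J \<Longrightarrow> A i \<in> sets (M' i)"
    \<comment> \<open>Enlarging \<open>J\<close> to an initial segment makes the cylinder a
      statement about prefixes, where \<open>C\<close> applies.\<close>
    obtain n where n: "J \<subseteq> {0..<n}"
      using J B.up_to by blast
    let ?X = "Pi\<^sub>E J A"
    have X: "?X \<in> sets (PiM J M')" using J A by (rule sets_PiM_I_finite)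
    have Xn: "B.PF.emb {0..<n} J ?X \<in> sets (PiM {0..<n} M')"
      by (rule measurable_prod_emb[OF n X])
    let ?Y = "G n -` B.PF.emb {0..<n} J ?X \<inter> space (PiM {0..<n} M)"
    have Y: "?Y \<in> sets (PiM {0..<n} M)"
      by (rule measurable_sets[OF G Xn]) simp
    have "emeasure B.PF.lim (B.PF.emb UNIV J ?X) = emeasure (B.C 0 n ?u) (B.PF.emb {0..<n} J ?X)"
      by (simp only: B.lim[OF J X] B.emeasure_CI[OF n X])
    also have "\<dots> = emeasure (A.C 0 n ?u) ?Y"
      unfolding C using Xn G[of n "{0..<n}"]
      by (subst emeasure_distr) (simp_all add: A.space_C measurable_cong_sets[OF A.sets_C refl])
    also have "\<dots> = emeasure A.PF.lim (A.PF.emb UNIV {0..<n} ?Y)"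
      using A.emeasure_CI[of "{0..<n}" n ?Y] A.lim[of "{0..<n}" ?Y] Y
        prod_emb_id[of ?Y "{0..<n}" M] sets.sets_into_space[OF Y] by (simp add: space_PiM)
    also have "A.PF.emb UNIV {0..<n} ?Y = F -` B.PF.emb UNIV J ?X \<inter> space A.PF.lim"
    proof -
      \<comment> \<open>On \<open>J\<close> the image depends only on coordinates below
        \<open>n\<close>, so cutting the path at \<open>n\<close> first changes nothing
        there.\<close>
      have "restrict (G n (restrict \<omega> {0..<n})) J = restrict (F \<omega>) J" for \<omega>
        using n nonanticipating[of _ "restrict \<omega> {0..<n}" \<omega>] by (fastforce simp: G_def)
      moreover have "F \<omega> \<in> space (PiM UNIV M')" "restrict \<omega> {0..<n} \<in> space (PiM {0..<n} M)"
        "G n (restrict \<omega> {0..<n}) \<in> space (PiM {0..<n} M')"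
        if "\<omega> \<in> space (PiM UNIV M)" for \<omega>
        using measurable_space[OF F that] measurable_space[OF G, of n "{0..<n}" "restrict \<omega> {0..<n}"] that
        by (auto simp: space_PiM)
      ultimately show ?thesis
        by (auto simp: prod_emb_def space_PiM[symmetric])
    qed
    also have "emeasure A.PF.lim \<dots> = emeasure (distr A.PF.lim (PiM UNIV M') F) (B.PF.emb UNIV J ?X)"
      using F X by (subst emeasure_distr) (simp_all add: measurable_cong_sets[OF A.PF.sets_lim refl])
    finally show "emeasure B.PF.lim (B.PF.emb UNIV J ?X) = \<dots>" .
  qed simp_all
qed

section \<open>The augmented trajectory, path by path\<close>

text \<open>The formula inside \<open>aug_history\<close> without its restriction to a finite
  prefix, so that one map serves infinite paths and, after restriction, histories.\<close>

definition augment_steps ::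
    "nat \<Rightarrow> (nat \<Rightarrow> ('s, 'a) step) \<Rightarrow> nat \<Rightarrow> ('s \<times> nat, 'a) step" where
  "augment_steps \<Delta> \<omega> i = (case \<omega> i of (a, r, d, s') \<Rightarrow>
    (a, r, int (budget \<Delta> \<omega> i) - of_bool d < 0, (s', budget \<Delta> \<omega> (Suc i))))"

lemma aug_history_eq:
  "aug_history \<Delta> t h = ((fst h, \<Delta>), restrict (augment_steps \<Delta> (snd h)) {0..<t})"
  by (simp add: aug_history_def augment_steps_def[abs_def] case_prod_beta')

lemma budget_0 [simp]: "budget \<Delta> \<omega> 0 = \<Delta>"
  by (simp add: budget_def)

lemma budget_Suc: "budget \<Delta> \<omega> (Suc i) = budget \<Delta> \<omega> i - of_bool (step_damage (\<omega> i))"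
  by (simp add: budget_def)

lemma budget_cong: "(\<And>j. j < i \<Longrightarrow> \<omega> j = \<omega>' j) \<Longrightarrow> budget \<Delta> \<omega> i = budget \<Delta> \<omega>' i"
  by (simp add: budget_def)

lemma budget_fun_upd [simp]: "budget \<Delta> (fun_upd \<omega> i x) i = budget \<Delta> \<omega> i"
  by (rule budget_cong) simp

lemma budget_le: "budget \<Delta> \<omega> i \<le> \<Delta>"
  by (simp add: budget_def)

lemma augment_steps_cong:
  "(\<And>j. j \<le> i \<Longrightarrow> \<omega> j = \<omega>' j) \<Longrightarrow> augment_steps \<Delta> \<omega> i = augment_steps \<Delta> \<omega>' i"
  using budget_cong[of i \<omega> \<omega>'] budget_cong[of "Suc i" \<omega> \<omega>'] by (simp add: augment_steps_def)

lemma step_reward_augment_steps [simp]: "step_reward (augment_steps \<Delta> \<omega> i) = step_reward (\<omega> i)"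
  by (simp add: step_reward_def augment_steps_def split: prod.split)

lemma step_damage_augment_steps [simp]:
  "step_damage (augment_steps \<Delta> \<omega> i) \<longleftrightarrow> budget \<Delta> \<omega> i = 0 \<and> step_damage (\<omega> i)"
  by (auto simp: step_damage_def augment_steps_def split: prod.split)

lemma state_at_aug_history:
  "i \<le> t \<Longrightarrow> state_at (aug_history \<Delta> t h) i = (state_at h i, budget \<Delta> (snd h) i)"
  by (cases i) (auto simp: aug_history_eq state_at_def step_state_def augment_steps_def split: prod.split)

text \<open>A failure is a damage that hits an exhausted budget, and the first one is damage number
  \<open>Suc \<Delta>\<close>. Truncation at 0 can produce later failures, but only on paths that
  already violate the bound. Hence the constraints agree on every single path, not just almost
  surely.\<close>

lemma augment_steps_no_damage_iff:
  "(\<forall>t. \<not> step_damage (augment_steps \<Delta> \<omega> t)) \<longleftrightarrow>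
    (\<Sum>t. of_bool (step_damage (\<omega> t)) :: ennreal) \<le> of_nat \<Delta>"
proof -
  define N :: "nat \<Rightarrow> nat" where "N n = (\<Sum>l<n. of_bool (step_damage (\<omega> l)))" for n
  have "(\<forall>t. \<not> step_damage (augment_steps \<Delta> \<omega> t)) \<longleftrightarrow> (\<forall>n. N n \<le> \<Delta>)"
  proof
    assume *: "\<forall>t. \<not> step_damage (augment_steps \<Delta> \<omega> t)"
    show "\<forall>n. N n \<le> \<Delta>"
    proof
      \<comment> \<open>A damage that is not a failure needs a positive budget, that is
        \<open>N n < \<Delta>\<close>, so the next count is still at most
        \<open>\<Delta>\<close>.\<close>
      fix n show "N n \<le> \<Delta>"
        using * by (induction n) (auto simp: N_def budget_def not_le Suc_le_eq)
    qed
  next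
    assume *: "\<forall>n. N n \<le> \<Delta>"
    show "\<forall>t. \<not> step_damage (augment_steps \<Delta> \<omega> t)"
    proof
      \<comment> \<open>At a failure the budget is 0, which under truncation means
        \<open>\<Delta> \<le> N t\<close>; the damage at \<open>t\<close> then pushes
        \<open>N (Suc t)\<close> above \<open>\<Delta>\<close>.\<close>
      fix t show "\<not> step_damage (augment_steps \<Delta> \<omega> t)"
        using *[rule_format, of "Suc t"] by (auto simp: N_def budget_def)
    qed
  qed
  also have "\<dots> \<longleftrightarrow> (\<forall>n. (\<Sum>l<n. of_bool (step_damage (\<omega> l)) :: ennreal) \<le> of_nat \<Delta>)"
  proof -
    have "(\<Sum>l<n. of_bool (step_damage (\<omega> l)) :: ennreal) = of_nat (N n)" for n
      by (simp add: N_def)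
    then show ?thesis by simp
  qed
  \<comment> \<open>In \<open>ennreal\<close> a series is the supremum of its partial sums, whether
    or not it is finite.\<close>
  also have "\<dots> \<longleftrightarrow> (\<Sum>t. of_bool (step_damage (\<omega> t)) :: ennreal) \<le> of_nat \<Delta>"
    by (simp add: suminf_eq_SUP SUP_le_iff)
  finally show ?thesis .
qed

section \<open>Measurability of the augmentation\<close>

lemma actions_augment [simp]: "actions (augment \<Delta> M) = actions M"
  and states_augment [simp]: "states (augment \<Delta> M) = states M \<times> {0..\<Delta>}"
  by (simp_all add: augment_def)

lemma measurable_step_action: "fst \<in> step_space M \<rightarrow>\<^sub>M count_space (actions M)"
  and measurable_step_reward: "step_reward \<in> step_space M \<rightarrow>\<^sub>M borel"
  and measurable_step_damage: "step_damage \<in> step_space M \<rightarrow>\<^sub>M count_space UNIV"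
  and measurable_step_state: "step_state \<in> step_space M \<rightarrow>\<^sub>M count_space (states M)"
  unfolding step_space_def step_reward_def step_damage_def step_state_def by measurable

lemma measurable_component_compose:
  assumes "f \<in> M i \<rightarrow>\<^sub>M K" "i \<in> J"
  shows "(\<lambda>\<omega>. f (\<omega> i)) \<in> PiM J M \<rightarrow>\<^sub>M K"
  using measurable_component_singleton[OF assms(2)] assms(1) by (rule measurable_compose)

text \<open>For countable sets the product sigma-algebra is discrete. Decrements and comparisons of
  discrete components are thus measurable as arbitrary functions on a count space.\<close>

lemma measurable_pair_count_space:
  assumes "f \<in> N \<rightarrow>\<^sub>M count_space A" "g \<in> N \<rightarrow>\<^sub>M count_space B" "countable A" "countable B"
  shows "(\<lambda>x. (f x, g x)) \<in> N \<rightarrow>\<^sub>M count_space (A \<times> B)"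
  using measurable_Pair[OF assms(1,2)] by (simp add: pair_measure_countable assms)

text \<open>Induction along \<open>budget_Suc\<close>. The target is \<open>{0..\<Delta>}\<close>
  and not all naturals because this is the budget component of the augmented state space.\<close>

lemma measurable_budget:
  "{0..<i} \<subseteq> J \<Longrightarrow> (\<lambda>\<omega>. budget \<Delta> \<omega> i) \<in> PiM J (\<lambda>_. step_space M) \<rightarrow>\<^sub>M count_space {0..\<Delta>}"
proof (induction i)
  case 0
  then show ?case by simp
next
  case (Suc i)
  have d: "(\<lambda>\<omega>. step_damage (\<omega> i)) \<in> PiM J (\<lambda>_. step_space M) \<rightarrow>\<^sub>M count_space UNIV"
    using Suc.prems by (intro measurable_component_compose measurable_step_damage) auto
  have b: "(\<lambda>\<omega>. budget \<Delta> \<omega> i) \<in> PiM J (\<lambda>_. step_space M) \<rightarrow>\<^sub>M count_space {0..\<Delta>}"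
    using Suc.prems by (intro Suc.IH) auto
  have "(\<lambda>(k, d). k - of_bool d) \<in> count_space ({0..\<Delta>} \<times> UNIV) \<rightarrow>\<^sub>M count_space {0..\<Delta>}"
    by auto
  from measurable_compose[OF measurable_pair_count_space[OF b d] this] show ?case
    by (simp add: budget_Suc)
qed

context finite_mdp
begin

lemma measurable_augment_steps:
  assumes "{0..<Suc i} \<subseteq> J"
  shows "(\<lambda>\<omega>. augment_steps \<Delta> \<omega> i) \<in>
    PiM J (\<lambda>_. step_space M) \<rightarrow>\<^sub>M step_space (augment \<Delta> M)"
proof -
  let ?H = "PiM J (\<lambda>_. step_space M)"
  have i: "(\<lambda>\<omega>. \<omega> i) \<in> ?H \<rightarrow>\<^sub>M step_space M"
    using assms by (intro measurable_component_singleton) auto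
  have b: "(\<lambda>\<omega>. budget \<Delta> \<omega> i) \<in> ?H \<rightarrow>\<^sub>M count_space {0..\<Delta>}"
    using assms by (intro measurable_budget) auto
  have "(\<lambda>\<omega>. (\<lambda>(k, d). int k - of_bool d < 0) (budget \<Delta> \<omega> i, step_damage (\<omega> i)))
      \<in> ?H \<rightarrow>\<^sub>M count_space UNIV"
    by (rule measurable_compose[OF measurable_pair_count_space
          [OF b measurable_compose[OF i measurable_step_damage]]]) auto
  moreover have "(\<lambda>\<omega>. (step_state (\<omega> i), budget \<Delta> \<omega> (Suc i))) \<in>
      ?H \<rightarrow>\<^sub>M count_space (states M \<times> {0..\<Delta>})"
    using assms by (intro measurable_pair_count_space measurable_compose[OF i measurable_step_state]
        measurable_budget countable_finite finite_states) auto
  ultimately have "(\<lambda>\<omega>. (fst (\<omega> i), step_reward (\<omega> i),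
      (\<lambda>(k, d). int k - of_bool d < 0) (budget \<Delta> \<omega> i, step_damage (\<omega> i)),
      (step_state (\<omega> i), budget \<Delta> \<omega> (Suc i)))) \<in> ?H \<rightarrow>\<^sub>M step_space (augment \<Delta> M)"
    unfolding step_space_def[of "augment \<Delta> M"] actions_augment states_augment
    by (intro measurable_Pair measurable_compose[OF i measurable_step_action]
        measurable_compose[OF i measurable_step_reward]) auto
  then show ?thesis
    by (simp add: augment_steps_def case_prod_beta' step_reward_def step_damage_def step_state_def)
qed

lemma measurable_aug_history:
  "aug_history \<Delta> t \<in> history_space M t \<rightarrow>\<^sub>M history_space (augment \<Delta> M) t"
  unfolding aug_history_eq[abs_def] history_space_def states_augment
proof (rule measurable_Pair)
  let ?N = "count_space (states M) \<Otimes>\<^sub>M PiM {0..<t} (\<lambda>_. step_space M)"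
  show "(\<lambda>h. (fst h, \<Delta>)) \<in> ?N \<rightarrow>\<^sub>M count_space (states M \<times> {0..\<Delta>})"
    by (rule measurable_compose[OF measurable_fst]) simp
  show "(\<lambda>h. restrict (augment_steps \<Delta> (snd h)) {0..<t}) \<in>
      ?N \<rightarrow>\<^sub>M PiM {0..<t} (\<lambda>_. step_space (augment \<Delta> M))"
    by (rule measurable_restrict, rule measurable_compose[OF measurable_snd],
        rule measurable_augment_steps) auto
qed

lemma step_kernel_in_prob_algebra:
  assumes "s \<in> states M" "a \<in> actions M"
  shows "distr (kernel M s a) (step_space M) (\<lambda>(s', r, d). (a, r, d, s')) \<in>
      space (prob_algebra (step_space M))"
    and "(\<lambda>(s', r, d). (a, r, d, s')) \<in> kernel M s a \<rightarrow>\<^sub>M step_space M"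
proof -
  have K: "kernel M s a \<in> space (prob_algebra (outcome_space (states M)))"
    using kernel assms by blast
  have "(\<lambda>(s', r, d). (a, r, d, s')) \<in> outcome_space (states M) \<rightarrow>\<^sub>M step_space M"
    unfolding outcome_space_def step_space_def case_prod_beta'
    by (intro measurable_Pair measurable_const measurable_compose[OF measurable_snd]
        measurable_fst measurable_snd) (simp add: assms)
  then show *: "(\<lambda>(s', r, d). (a, r, d, s')) \<in> kernel M s a \<rightarrow>\<^sub>M step_space M"
    using K by (simp add: space_prob_algebra cong: measurable_cong_sets)
  show "distr (kernel M s a) (step_space M) (\<lambda>(s', r, d). (a, r, d, s')) \<in>
      space (prob_algebra (step_space M))"
    using K * by (auto simp: space_prob_algebra intro!: prob_space.prob_space_distr)
qed

lemma measurable_augment_outcome: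
  assumes "k \<le> \<Delta>"
  shows "(\<lambda>(s', r, d). ((s', k - of_bool d), r, int k - of_bool d < 0)) \<in>
    outcome_space (states M) \<rightarrow>\<^sub>M outcome_space (states M \<times> {0..\<Delta>})"
proof -
  let ?N = "outcome_space (states M)"
  have d: "(\<lambda>x. snd (snd x)) \<in> ?N \<rightarrow>\<^sub>M count_space UNIV"
    unfolding outcome_space_def by measurable
  have "(\<lambda>x. k - of_bool (snd (snd x))) \<in> ?N \<rightarrow>\<^sub>M count_space {0..\<Delta>}"
    by (rule measurable_compose[OF d]) (use assms in auto)
  then have "(\<lambda>x. (fst x, k - of_bool (snd (snd x)))) \<in> ?N \<rightarrow>\<^sub>M count_space (states M \<times> {0..\<Delta>})"
    by (intro measurable_pair_count_space countable_finite finite_states)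
      (simp_all add: outcome_space_def)
  then show ?thesis
    unfolding outcome_space_def[of "states M \<times> {0..\<Delta>}"] case_prod_beta'
    by (intro measurable_Pair measurable_compose[OF d]) (auto simp: outcome_space_def)
qed

section \<open>Push-forward of the trajectory law\<close>

text \<open>Correspondence makes both sides draw the action from the same distribution. Given the
  action, the budget may be updated on the kernel outcome, as in \<open>augment\<close>, or on the
  finished step, as in \<open>augment_steps\<close>: the two routes commute.\<close>

lemma step_law_augment:
  assumes \<pi>: "\<pi> \<in> policies M" and s: "s \<in> states M" and corr: "corresponds \<Delta> M \<pi>' \<pi>"
    and \<omega>: "\<omega> \<in> space (PiM {0..<n} (\<lambda>_. step_space M))"
  shows "step_law (augment \<Delta> M) \<pi>' (s, \<Delta>) n (restrict (augment_steps \<Delta> \<omega>) {0..<n}) =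
    distr (step_law M \<pi> s n \<omega>) (step_space (augment \<Delta> M)) (\<lambda>x. augment_steps \<Delta> (fun_upd \<omega> n x) n)"
proof -
  interpret aug: finite_mdp "augment \<Delta> M" by (rule finite_mdp_augment)
  let ?S = "step_space M" and ?S' = "step_space (augment \<Delta> M)"
  let ?h' = "((s, \<Delta>), restrict (augment_steps \<Delta> \<omega>) {0..<n})"
  let ?z = "state_at (s, \<omega>) n" and ?k = "budget \<Delta> \<omega> n"
  let ?F = "\<lambda>x. augment_steps \<Delta> (fun_upd \<omega> n x) n"
  have h: "(s, \<omega>) \<in> space (history_space M n)"
    using s \<omega> by (simp add: history_space_def space_pair_measure)
  have h': "?h' = aug_history \<Delta> n (s, \<omega>)" by (simp add: aug_history_eq)
  have pol: "\<pi>' n ?h' = \<pi> n (s, \<omega>)"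
    using corr h unfolding corresponds_def h' by blast
  have st: "state_at ?h' n = (?z, ?k)"
    unfolding h' by (subst state_at_aug_history) auto
  have z: "?z \<in> states M"
    using measurable_space[OF measurable_state_at[OF s] \<omega>] by simp
  have p: "\<pi> n (s, \<omega>) \<in> space (prob_algebra (count_space (actions M)))"
    using \<pi> measurable_space[OF _ h] by (auto simp: policies_def)
  have sets_p: "sets (\<pi> n (s, \<omega>)) = sets (count_space (actions M))"
    and ne: "space (\<pi> n (s, \<omega>)) \<noteq> {}"
    using p by (auto simp: space_prob_algebra prob_space.not_empty)
  have F: "?F \<in> ?S \<rightarrow>\<^sub>M ?S'"
    by (rule measurable_compose[OF _ measurable_augment_steps[of n "{0..<Suc n}"]])
      (auto intro!: measurable_fun_upd[where J="{0..<n}"] measurable_const \<omega>)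
  let ?Q = "\<lambda>a. distr (kernel M ?z a) ?S (\<lambda>(s', r, d). (a, r, d, s'))"
  \<comment> \<open>Actions form a discrete space, so only membership of the values has to be
    checked.\<close>
  have Q: "?Q \<in> \<pi> n (s, \<omega>) \<rightarrow>\<^sub>M subprob_algebra ?S"
    unfolding measurable_cong_sets[OF sets_p refl]
    using step_kernel_in_prob_algebra(1)[OF z]
    by (auto simp: space_prob_algebra space_subprob_algebra prob_space_imp_subprob_space)
  have eq: "distr (kernel (augment \<Delta> M) (?z, ?k) a) ?S' (\<lambda>(s', r, d). (a, r, d, s')) =
      distr (?Q a) ?S' ?F" if a: "a \<in> actions M" for a
  proof -
    let ?f = "\<lambda>(s', r, d). ((s', ?k - of_bool d), r :: real, int ?k - of_bool d < 0)"
    let ?O = "outcome_space (states M \<times> {0..\<Delta>})"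
    have zk: "(?z, ?k) \<in> states (augment \<Delta> M)"
      using z by (simp add: budget_le)
    have aug: "kernel (augment \<Delta> M) (?z, ?k) a = distr (kernel M ?z a) ?O ?f"
      by (simp add: augment_def)
    have "kernel M ?z a \<in> space (prob_algebra (outcome_space (states M)))"
      using kernel z a by blast
    then have f: "?f \<in> kernel M ?z a \<rightarrow>\<^sub>M ?O"
      using measurable_augment_outcome[OF budget_le]
      by (simp add: space_prob_algebra cong: measurable_cong_sets)
    \<comment> \<open>The augmented kernel is a \<open>distr\<close> with target \<open>?O\<close>,
      so measurability on it is measurability on \<open>?O\<close>.\<close>
    have "(\<lambda>(s', r, d). (a, r, d, s')) \<in> kernel (augment \<Delta> M) (?z, ?k) a \<rightarrow>\<^sub>M ?S'"
      using zk a by (intro aug.step_kernel_in_prob_algebra(2)) auto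
    then have g: "(\<lambda>(s', r, d). (a, r, d, s')) \<in> ?O \<rightarrow>\<^sub>M ?S'"
      unfolding aug by simp
    \<comment> \<open>Both sides are images of \<open>kernel M ?z a\<close> under composite maps.
      These agree because overwriting entry \<open>n\<close> leaves the budget at time
      \<open>n\<close> unchanged.\<close>
    show ?thesis
      unfolding aug distr_distr[OF g f] distr_distr[OF F step_kernel_in_prob_algebra(2)[OF z a]]
      by (rule arg_cong2[where f="distr (kernel M ?z a)"])
        (auto simp: augment_steps_def budget_Suc step_damage_def)
  qed
  show ?thesis
    unfolding step_law_def pol st distr_bind[OF Q ne F]
    using eq by (intro bind_cong refl) (simp add: sets_eq_imp_space_eq[OF sets_p])
qed

text \<open>Coordinate \<open>i\<close> of the image uses only steps up to \<open>i\<close>, and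
  \<open>step_law_augment\<close> is the one-step condition, so the general push-forward result
  applies.\<close>

lemma trajectory_augment:
  assumes \<pi>: "\<pi> \<in> policies M" and \<pi>': "\<pi>' \<in> policies (augment \<Delta> M)"
    and s: "s \<in> states M" and corr: "corresponds \<Delta> M \<pi>' \<pi>"
  shows "trajectory (augment \<Delta> M) \<pi>' (s, \<Delta>) =
    distr (trajectory M \<pi> s) (PiM UNIV (\<lambda>_. step_space (augment \<Delta> M))) (augment_steps \<Delta>)"
  unfolding trajectory_def
proof (rule Ionescu_Tulcea_lim_distr)
  show "Ionescu_Tulcea (step_law M \<pi> s) (\<lambda>_. step_space M)"
    by (rule Ionescu_Tulcea_step_law[OF \<pi> s])
  show "Ionescu_Tulcea (step_law (augment \<Delta> M) \<pi>' (s, \<Delta>)) (\<lambda>_. step_space (augment \<Delta> M))"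
    using s by (intro finite_mdp.Ionescu_Tulcea_step_law finite_mdp_augment \<pi>') auto
qed (auto intro: measurable_augment_steps augment_steps_cong step_law_augment[OF \<pi> s corr])

end

section \<open>Recovering histories and transporting policies\<close>

text \<open>\<open>state_at h i\<close> is the state before step \<open>i\<close>, while
  \<open>(s', k)\<close> is the state after it. The stored flag \<open>d\<close> only records
  failures; the drop in budget detects the damages that the budget absorbs. The map is defined on
  all augmented histories, also outside the image of \<open>aug_history\<close>.\<close>

definition forget_budget :: "nat \<Rightarrow> ('s \<times> nat, 'a) history \<Rightarrow> ('s, 'a) history" where
  "forget_budget t h = (fst (fst h), \<lambda>i\<in>{0..<t}. case snd h i of (a, r, d, (s', k)) \<Rightarrow>
    (a, r, d \<or> k < snd (state_at h i), s'))"

text \<open>A damage lowers a positive budget and raises the failure flag at budget 0; without a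
  damage neither happens. The disjunction in \<open>forget_budget\<close> therefore returns the
  original indicator.\<close>

lemma forget_budget_aug_history:
  assumes "h \<in> space (history_space M t)"
  shows "forget_budget t (aug_history \<Delta> t h) = h"
proof (rule prod_eqI)
  show "fst (forget_budget t (aug_history \<Delta> t h)) = fst h"
    by (simp add: forget_budget_def aug_history_eq)
  \<comment> \<open>From index \<open>t\<close> on a history is \<open>undefined\<close>, as is the
    restricted function in \<open>forget_budget\<close>.\<close>
  have ext: "snd h \<in> extensional {0..<t}"
    using assms by (auto simp: history_space_def space_pair_measure space_PiM PiE_def)
  show "snd (forget_budget t (aug_history \<Delta> t h)) = snd h"
  proof
    fix i
    show "snd (forget_budget t (aug_history \<Delta> t h)) i = snd h i"
    proof (cases "i < t")
      case True
      obtain a r d s' where x: "snd h i = (a, r, d, s')" by (cases "snd h i")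
      have "snd (aug_history \<Delta> t h) i = augment_steps \<Delta> (snd h) i"
        using True by (simp add: aug_history_eq)
      also have "\<dots> = (a, r, int (budget \<Delta> (snd h) i) - of_bool d < 0,
          (s', budget \<Delta> (snd h) i - of_bool d))"
        by (simp add: augment_steps_def x budget_Suc step_damage_def)
      finally show ?thesis
        using True x state_at_aug_history[of i t \<Delta> h] by (auto simp: forget_budget_def)
    next
      case False
      then show ?thesis using ext by (simp add: forget_budget_def extensional_def)
    qed
  qed
qed

context finite_mdp
begin

lemma measurable_forget_budget:
  "forget_budget t \<in> history_space (augment \<Delta> M) t \<rightarrow>\<^sub>M history_space M t"
proof -
  let ?S' = "step_space (augment \<Delta> M)" and ?A = "states M \<times> {0..\<Delta>}"
  let ?P = "PiM {0..<t} (\<lambda>_. ?S')"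
  let ?N = "count_space ?A \<Otimes>\<^sub>M ?P"
  have fstN: "(\<lambda>h. fst h) \<in> ?N \<rightarrow>\<^sub>M count_space ?A" by simp
  have i: "(\<lambda>h. snd h i) \<in> ?N \<rightarrow>\<^sub>M ?S'" if "i < t" for i
    using that by (intro measurable_compose[OF measurable_snd] measurable_component_singleton) auto
  have st: "step_state \<in> ?S' \<rightarrow>\<^sub>M count_space ?A"
    using measurable_step_state[of "augment \<Delta> M"] by simp
  have at: "(\<lambda>h. state_at h i) \<in> ?N \<rightarrow>\<^sub>M count_space ?A" if "i < t" for i
  proof (cases i)
    case 0
    then show ?thesis by (simp add: state_at_def)
  next
    case (Suc j)
    with that measurable_compose[OF i[of j] st] show ?thesis by (simp add: state_at_def)
  qed
  \<comment> \<open>The entries of \<open>forget_budget\<close>, with the damage flag written as a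
    function of a discrete triple, where every map is measurable.\<close>
  define g :: "('s \<times> nat, 'a) history \<Rightarrow> nat \<Rightarrow> ('s, 'a) step" where
    "g h i = (fst (snd h i), step_reward (snd h i),
      (\<lambda>(d, z, z'). d \<or> snd z < snd z') (step_damage (snd h i), step_state (snd h i), state_at h i),
      fst (step_state (snd h i)))" for h i
  have g: "(\<lambda>h. g h i) \<in> ?N \<rightarrow>\<^sub>M step_space M" if "i < t" for i
  proof -
    have "countable ?A" by (intro countable_finite finite_cartesian_product finite_states) simp
    then have "(\<lambda>h. (step_damage (snd h i), step_state (snd h i), state_at h i)) \<in>
        ?N \<rightarrow>\<^sub>M count_space (UNIV \<times> ?A \<times> ?A)"
      using measurable_compose[OF i[OF that] measurable_step_damage]
        measurable_compose[OF i[OF that] st] at[OF that]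
      by (intro measurable_pair_count_space) (simp_all only: countable_SIGMA countableI_type)
    then have "(\<lambda>h. (\<lambda>(d, z, z'). d \<or> snd z < snd z')
        (step_damage (snd h i), step_state (snd h i), state_at h i)) \<in> ?N \<rightarrow>\<^sub>M count_space UNIV"
      by (rule measurable_compose) simp
    moreover have "(\<lambda>h. fst (step_state (snd h i))) \<in> ?N \<rightarrow>\<^sub>M count_space (states M)"
      by (rule measurable_compose[OF measurable_compose[OF i[OF that] st]]) auto
    moreover have "(\<lambda>h. fst (snd h i)) \<in> ?N \<rightarrow>\<^sub>M count_space (actions M)"
      using measurable_compose[OF i[OF that] measurable_step_action] by simp
    ultimately show ?thesis
      unfolding step_space_def[of M] g_def
      by (intro measurable_Pair measurable_compose[OF i[OF that] measurable_step_reward])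
  qed
  have "forget_budget t h = (fst (fst h), restrict (g h) {0..<t})" for h
    by (simp add: forget_budget_def g_def[abs_def] case_prod_beta'
        step_reward_def step_damage_def step_state_def)
  moreover have "(\<lambda>h. (fst (fst h), restrict (g h) {0..<t})) \<in>
      ?N \<rightarrow>\<^sub>M count_space (states M) \<Otimes>\<^sub>M PiM {0..<t} (\<lambda>_. step_space M)"
    by (intro measurable_Pair measurable_restrict measurable_compose[OF fstN] g) auto
  ultimately show ?thesis
    unfolding history_space_def states_augment by presburger
qed

text \<open>Pull-back along \<open>aug_history\<close>; its measurability makes the result a
  policy.\<close>

lemma corresponding_policy:
  assumes "\<pi>' \<in> policies (augment \<Delta> M)"
  shows "\<exists>\<pi>\<in>policies M. corresponds \<Delta> M \<pi>' \<pi>"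
proof
  show "(\<lambda>t h. \<pi>' t (aug_history \<Delta> t h)) \<in> policies M"
    using assms by (auto simp: policies_def intro: measurable_compose[OF measurable_aug_history])
qed (simp add: corresponds_def)

text \<open>Pull-back along the left inverse. Correspondence constrains only the image of
  \<open>aug_history\<close>, so any measurable choice elsewhere will do.\<close>

lemma corresponding_augmented_policy:
  assumes "\<pi> \<in> policies M"
  shows "\<exists>\<pi>'\<in>policies (augment \<Delta> M). corresponds \<Delta> M \<pi>' \<pi>"
proof
  show "(\<lambda>t h. \<pi> t (forget_budget t h)) \<in> policies (augment \<Delta> M)"
    using assms by (auto simp: policies_def intro: measurable_compose[OF measurable_forget_budget])
qed (simp add: corresponds_def forget_budget_aug_history)

section \<open>Trajectory laws and almost sure constraints\<close>

lemma
  assumes "\<pi> \<in> policies M" "s \<in> states M"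
  shows prob_space_trajectory: "prob_space (trajectory M \<pi> s)"
    and sets_trajectory: "sets (trajectory M \<pi> s) = sets (PiM UNIV (\<lambda>_. step_space M))"
proof -
  interpret Ionescu_Tulcea "step_law M \<pi> s" "\<lambda>_. step_space M"
    by (rule Ionescu_Tulcea_step_law[OF assms])
  show "sets (trajectory M \<pi> s) = sets (PiM UNIV (\<lambda>_. step_space M))"
    by (simp add: trajectory_def)
  have "emeasure PF.lim (PF.emb UNIV {} (space (PiM {} (\<lambda>_. step_space M)))) = 1"
    using prob_space.emeasure_space_1[OF PF.prob_space_P[of "{}"]]
    by (subst lim) (auto simp: PF.space_P)
  moreover have "PF.emb UNIV {} (space (PiM {} (\<lambda>_. step_space M))) = space PF.lim"
    by (auto simp: prod_emb_def space_PiM)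
  ultimately show "prob_space (trajectory M \<pi> s)"
    unfolding trajectory_def by (intro prob_spaceI) simp
qed

lemma measurable_trajectory_component:
  assumes "\<pi> \<in> policies M" "s \<in> states M"
  shows "(\<lambda>\<omega>. \<omega> t) \<in> trajectory M \<pi> s \<rightarrow>\<^sub>M step_space M"
  unfolding measurable_cong_sets[OF sets_trajectory[OF assms] refl]
  by (intro measurable_component_singleton) simp

text \<open>The damage count is a countable sum of measurable functions, so the event is measurable
  and probability 1 means almost surely. The \<open>AE\<close> form is the one that passes through
  \<open>distr\<close>.\<close>

lemma feasible_iff:
  assumes "s \<in> states M"
  shows "\<pi> \<in> feasible \<Delta> M s \<longleftrightarrow> \<pi> \<in> policies M \<and>
    (AE \<omega> in trajectory M \<pi> s. (\<Sum>t. of_bool (step_damage (\<omega> t)) :: ennreal) \<le> of_nat \<Delta>)"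
proof (cases "\<pi> \<in> policies M")
  case True
  interpret prob_space "trajectory M \<pi> s" by (rule prob_space_trajectory[OF True assms])
  have "(\<lambda>\<omega>. of_bool (step_damage (\<omega> t)) :: ennreal) \<in> borel_measurable (trajectory M \<pi> s)" for t
    by (rule measurable_compose[OF measurable_compose
          [OF measurable_trajectory_component[OF True assms] measurable_step_damage]]) simp
  then have "{\<omega> \<in> space (trajectory M \<pi> s).
      (\<Sum>t. of_bool (step_damage (\<omega> t)) :: ennreal) \<le> of_nat \<Delta>} \<in> events"
    by measurable
  then show ?thesis
    using True by (simp add: feasible_def prob_Collect_eq_1)
qed (simp add: feasible_def)

text \<open>Countably many null sets combine into one, which turns the constraints for single times
  into a condition on whole paths.\<close>

lemma AE_no_damage_iff:
  assumes "\<pi> \<in> policies M" "s \<in> states M"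
  shows "(\<forall>t. \<P>(\<omega> in trajectory M \<pi> s. \<not> step_damage (\<omega> t)) = 1) \<longleftrightarrow>
    (AE \<omega> in trajectory M \<pi> s. \<forall>t. \<not> step_damage (\<omega> t))"
proof -
  interpret prob_space "trajectory M \<pi> s" by (rule prob_space_trajectory[OF assms])
  have "{\<omega> \<in> space (trajectory M \<pi> s). \<not> step_damage (\<omega> t)} \<in> events" for t
    using measurable_compose[OF measurable_trajectory_component[OF assms] measurable_step_damage]
    by measurable
  then show ?thesis by (simp add: prob_Collect_eq_1 AE_all_countable)
qed

section \<open>Feasibility and return of a corresponding pair of policies\<close>

context
  fixes \<Delta> s \<pi> \<pi>'
  assumes \<pi>: "\<pi> \<in> policies M" and \<pi>': "\<pi>' \<in> policies (augment \<Delta> M)"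
    and s: "s \<in> states M" and corr: "corresponds \<Delta> M \<pi>' \<pi>"
begin

lemma measurable_augment_steps_trajectory:
  "augment_steps \<Delta> \<in> trajectory M \<pi> s \<rightarrow>\<^sub>M PiM UNIV (\<lambda>_. step_space (augment \<Delta> M))"
proof -
  have "(\<lambda>\<omega>. \<lambda>i\<in>UNIV. augment_steps \<Delta> \<omega> i) \<in>
      trajectory M \<pi> s \<rightarrow>\<^sub>M PiM UNIV (\<lambda>_. step_space (augment \<Delta> M))"
    unfolding measurable_cong_sets[OF sets_trajectory[OF \<pi> s] refl]
    by (intro measurable_restrict measurable_augment_steps) simp
  then show ?thesis by (simp add: restrict_UNIV)
qed

text \<open>The push-forward identity moves the failure constraint to the trajectory law of
  \<open>M\<close>, where it coincides path by path with the damage bound.\<close>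

lemma feasible_aug_iff_feasible: "\<pi>' \<in> feasible_aug \<Delta> M s \<longleftrightarrow> \<pi> \<in> feasible \<Delta> M s"
proof -
  interpret aug: finite_mdp "augment \<Delta> M" by (rule finite_mdp_augment)
  have s': "(s, \<Delta>) \<in> states (augment \<Delta> M)" using s by simp
  let ?N = "PiM UNIV (\<lambda>_ :: nat. step_space (augment \<Delta> M))"
  have "(\<lambda>\<omega>. step_damage (\<omega> t)) \<in> ?N \<rightarrow>\<^sub>M count_space UNIV" for t
    by (intro measurable_component_compose measurable_step_damage) simp
  then have meas: "{\<omega> \<in> space ?N. \<forall>t. \<not> step_damage (\<omega> t)} \<in> sets ?N"
    by measurable
  have "\<pi>' \<in> feasible_aug \<Delta> M s \<longleftrightarrow>
      (AE \<omega> in trajectory (augment \<Delta> M) \<pi>' (s, \<Delta>). \<forall>t. \<not> step_damage (\<omega> t))"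
    using \<pi>' aug.AE_no_damage_iff[OF \<pi>' s'] by (simp add: feasible_aug_def)
  also have "\<dots> \<longleftrightarrow> (AE \<omega> in trajectory M \<pi> s. \<forall>t. \<not> step_damage (augment_steps \<Delta> \<omega> t))"
    unfolding trajectory_augment[OF \<pi> \<pi>' s corr]
    by (rule AE_distr_iff[OF measurable_augment_steps_trajectory meas])
  also have "\<dots> \<longleftrightarrow> \<pi> \<in> feasible \<Delta> M s"
    using \<pi> by (simp only: augment_steps_no_damage_iff feasible_iff[OF s] simp_thms)
  finally show ?thesis .
qed

text \<open>Change of variables: the path map keeps every reward, so \<open>total_reward\<close> is
  invariant even on paths whose rewards are not summable. Integrability transfers as well, which
  covers undefined returns.\<close>

lemma has_return_augment_iff: "has_return (augment \<Delta> M) (s, \<Delta>) \<pi>' v \<longleftrightarrow> has_return M s \<pi> v"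
proof -
  let ?N = "PiM UNIV (\<lambda>_ :: nat. step_space (augment \<Delta> M))"
  have "(\<lambda>\<omega>. step_reward (\<omega> t)) \<in> borel_measurable ?N" for t
    by (intro measurable_component_compose measurable_step_reward) simp
  then have meas: "total_reward \<in> borel_measurable ?N"
    unfolding total_reward_def[abs_def] by measurable
  have "total_reward (augment_steps \<Delta> \<omega>) = total_reward \<omega>" for \<omega> :: "nat \<Rightarrow> ('s, 'a) step"
    by (simp add: total_reward_def)
  then show ?thesis
    unfolding has_return_def trajectory_augment[OF \<pi> \<pi>' s corr]
    using measurable_augment_steps_trajectory meas
    by (simp add: has_bochner_integral_iff integrable_distr_eq integral_distr)
qed

end

section \<open>Equivalence of the two problems\<close>

text \<open>Transport of policies supplies a partner in each direction; feasibility is invariant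
  under correspondence, so the partner is feasible too.\<close>

lemma equivalent_problems_augment:
  assumes s: "s \<in> states M"
  shows "equivalent_problems (corresponds \<Delta> M)
      (feasible_aug \<Delta> M s) (has_return (augment \<Delta> M) (s, \<Delta>))
      (feasible \<Delta> M s) (has_return M s)"
proof -
  have F: "\<pi> \<in> policies M" if "\<pi> \<in> feasible \<Delta> M s" for \<pi>
    using that by (simp add: feasible_def)
  have F': "\<pi>' \<in> policies (augment \<Delta> M)" if "\<pi>' \<in> feasible_aug \<Delta> M s" for \<pi>'
    using that by (simp add: feasible_aug_def)
  show ?thesis
    unfolding equivalent_problems_def
  proof (intro conjI ballI impI allI)
    fix \<pi>' assume *: "\<pi>' \<in> feasible_aug \<Delta> M s"
    then show "\<exists>\<pi>\<in>feasible \<Delta> M s. corresponds \<Delta> M \<pi>' \<pi>"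
      using corresponding_policy[OF F'[OF *]] feasible_aug_iff_feasible[OF _ F'[OF *] s] by blast
  next
    fix \<pi> assume *: "\<pi> \<in> feasible \<Delta> M s"
    then show "\<exists>\<pi>'\<in>feasible_aug \<Delta> M s. corresponds \<Delta> M \<pi>' \<pi>"
      using corresponding_augmented_policy[OF F[OF *]] feasible_aug_iff_feasible[OF F[OF *] _ s] by blast
  next
    fix \<pi>' \<pi> v
    assume "\<pi>' \<in> feasible_aug \<Delta> M s" "\<pi> \<in> feasible \<Delta> M s" "corresponds \<Delta> M \<pi>' \<pi>"
    then show "has_return (augment \<Delta> M) (s, \<Delta>) \<pi>' v \<longleftrightarrow> has_return M s \<pi> v"
      using has_return_augment_iff F F' s by blast
  qed
qed

end

theorem lemma5:
  fixes M :: "('s, 'a) mdp" and \<Delta> :: nat and s :: 's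
  assumes "cmdp M" and "s \<in> states M"
  shows "equivalent_problems (corresponds \<Delta> M)
      (feasible_aug \<Delta> M s) (has_return (augment \<Delta> M) (s, \<Delta>))
      (feasible \<Delta> M s) (has_return M s) \<and>
    optimal_value (feasible_aug \<Delta> M s) (has_return (augment \<Delta> M) (s, \<Delta>)) =
      optimal_value (feasible \<Delta> M s) (has_return M s) \<and>
    (\<forall>\<pi>'\<in>feasible_aug \<Delta> M s. \<forall>\<pi>\<in>feasible \<Delta> M s. corresponds \<Delta> M \<pi>' \<pi> \<longrightarrow>
      (maximizer (feasible_aug \<Delta> M s) (has_return (augment \<Delta> M) (s, \<Delta>)) \<pi>' \<longleftrightarrow>
       maximizer (feasible \<Delta> M s) (has_return M s) \<pi>))"
proof -
  interpret cmdp M by fact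
  \<comment> \<open>Equality of optimal values and the matching of maximizers are formal
    consequences of this equivalence.\<close>
  note eq = equivalent_problems_augment[OF assms(2), of \<Delta>]
  show ?thesis
    using eq equivalent_problems_optimal_value[OF eq] equivalent_problems_maximizer[OF eq] by blast
qed

end
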